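(* Let $(f_j)_{j\ge1}$ be an orthonormal system in $L^2(\mathbf T)$ with $\sum_{k\in\mathbb Z}|\mathscr F_xf_j(k)|^2=1$, $(\lambda_j)_j\in\ell^2$, $\gamma_0=\sum_j\lambda_j|f_j\rangle\langle f_j|$ (so $\|\gamma_0\|_{\mathfrak S^2}=(\sum_j|\lambda_j|^2)^{1/2}$), and let $f_j^\omega=\sum_{k\in\mathbb Z}g_k^{(1)}(\omega)e^{ixk}\mathscr F_xf_j(k)$. Fix $x\in\mathbf T$ and put $$F(t,\omega,\tilde\omega)=\sum_{j=1}^\infty\lambda_jg_j^{(2)}(\tilde\omega)\Big(|f_j^\omega(x)|^2-\big|e^{it\sqrt{\partial_x^4-\partial_x^2}}f_j^\omega(x)\big|^2\Big).$$ Then there is $C>0$ such that for every $\epsilon\in(0,1)$ there exists $\delta>0$ such that for all $|t|<\delta$ and all $r\in[2,\infty)$, $$\|F(t,\cdot,\cdot)\|_{L^r_{\omega,\tilde\omega}(\Omega\times\tilde\Omega)}\le Cr^{3/2}\epsilon^2(\|\gamma_0\|_{\mathfrak S^2}+1),$$ and moreover $$\lim_{t\to0}(\mathbb P\times\tilde{\mathbb P})\big(\{(\omega,\tilde\omega):|F(t,\omega,\tilde\omega)|>C\alpha_2\}\big)=0,\qquad \alpha_2=(\|\gamma_0\|_{\mathfrak S^2}+1)\,e\,\epsilon^{1/2}\big(\epsilon\ln\tfrac1\epsilon\big)^{3/2}.$$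
   Context: $\mathbf T=[0,2\pi)$, $\mathscr F_xf(k)=\frac1{2\pi}\int_{\mathbf T}e^{-ixk}f(x)dx$; on $\mathbf T$, $e^{it\sqrt{\partial_x^4-\partial_x^2}}$ multiplies the $k$-th Fourier coefficient by $e^{it\sqrt{k^4+k^2}}$. $(g_k^{(1)})_{k\in\mathbb Z}$ are independent, zero-mean, real random variables on $(\Omega,\mathcal A,\mathbb P)$ and $(g_j^{(2)})_{j\ge1}$ independent, zero-mean, real random variables on $(\tilde\Omega,\tilde{\mathcal A},\tilde{\mathbb P})$, whose distributions $\mu$ all satisfy $|\int e^{\gamma x}d\mu(x)|\le e^{c\gamma^2}$ for all $\gamma\in\mathbb{R}$, with fixed $c>0$. $L^r(\Omega\times\tilde\Omega)$ is with respect to $\mathbb P\times\tilde{\mathbb P}$. *)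

theory Defs
  imports "HOL-Probability.Probability"
begin

definition lim0 :: "(nat \<Rightarrow> complex) \<Rightarrow> complex" where
  "lim0 X = (if convergent X then lim X else 0)"

definition fourier_coeff :: "(real \<Rightarrow> complex) \<Rightarrow> int \<Rightarrow> complex" where
  "fourier_coeff f k =
     (LINT y:{0..<2*pi}|lborel. cis (- y * of_int k) * f y) / complex_of_real (2*pi)"

definition inner_T :: "(real \<Rightarrow> complex) \<Rightarrow> (real \<Rightarrow> complex) \<Rightarrow> complex" where
  "inner_T f h = (LINT y:{0..<2*pi}|lborel. f y * cnj (h y)) / complex_of_real (2*pi)"

text \<open>Value at x of e^{it sqrt(d^4 - d^2)} applied to the randomised function
  sum_k g_k(omega) e^{ixk} hat f(k); the series over k in Z is taken as the limit of
  the symmetric partial sums (value 0 if it diverges).\<close>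
definition rand_prop :: "(int \<Rightarrow> 'a \<Rightarrow> real) \<Rightarrow> (real \<Rightarrow> complex) \<Rightarrow> real \<Rightarrow> real \<Rightarrow> 'a \<Rightarrow> complex" where
  "rand_prop g f t x \<omega> =
     lim0 (\<lambda>N. \<Sum>k\<in>{- int N..int N}.
        complex_of_real (g k \<omega>) * cis (x * of_int k)
          * cis (t * sqrt (of_int k ^ 4 + of_int k ^ 2)) * fourier_coeff f k)"

definition series0 :: "(nat \<Rightarrow> complex) \<Rightarrow> complex" where
  "series0 a = lim0 (\<lambda>n. \<Sum>j<n. a j)"

end

theory Submission
  imports Defs
begin

text \<open>
  Comparing \<open>y\<^sup>r\<close> with an exponential turns the subgaussian bound on the moment generating function
  of a finite sum \<open>\<Sum> a\<^sub>i g\<^sub>i\<close> into a Khinchine inequality: its \<open>L\<^sup>r\<close> norm is \<open>O(\<surd>r \<parallel>a\<parallel>)\<close> with the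
  \<open>\<ell>\<^sup>2\<close> norm of \<open>a\<close>. Fatou's lemma carries this over to series, and Ottaviani's maximal inequality
  shows that these converge almost surely. If \<open>U\<^sub>j\<close> and \<open>V\<^sub>j\<close> are the values at \<open>x\<close> of the \<open>j\<close>-th
  randomised function at times \<open>0\<close> and \<open>t\<close>, then
  \<open>| |U\<^sub>j|\<^sup>2 - |V\<^sub>j|\<^sup>2 | \<le> (|U\<^sub>j| + |V\<^sub>j|) |U\<^sub>j - V\<^sub>j|\<close>, and the Cauchy-Schwarz inequality bounds
  the \<open>L\<^sup>r\<close> norm of this difference by \<open>O(r h\<^sub>j(t))\<close>, where \<open>h\<^sub>j(t)\<close> is the \<open>\<ell>\<^sup>2\<close> distance which the
  Fourier coefficients of the \<open>j\<close>-th function have travelled. The second randomisation costs another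
  factor \<open>\<surd>r\<close>, and Minkowski's inequality in \<open>L\<^bsup>r/2\<^esup>\<close> gives
  \<open>\<parallel>F(t)\<parallel>\<^sub>r = O(r\<^bsup>3/2\<^esup> (\<Sum> |\<lambda>\<^sub>j|\<^sup>2 h\<^sub>j(t)\<^sup>2)\<^bsup>1/2\<^esup>)\<close>. As \<open>h\<^sub>j \<le> 2\<close> and \<open>h\<^sub>j(t) \<rightarrow> 0\<close>, the last
  factor tends to \<open>0\<close> by dominated convergence, and Markov's inequality for \<open>r = 2\<close> yields
  the limit in probability.
\<close>

section \<open>Square-summable families\<close>

definition square_summable :: "('i \<Rightarrow> 'b::real_normed_vector) \<Rightarrow> bool" where
  "square_summable a \<longleftrightarrow> (\<lambda>i. (norm (a i))\<^sup>2) summable_on UNIV"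

definition l2_norm :: "('i \<Rightarrow> 'b::real_normed_vector) \<Rightarrow> real" where
  "l2_norm a = sqrt (\<Sum>\<^sub>\<infinity>i. (norm (a i))\<^sup>2)"

lemma l2_norm_nonneg [simp]: "0 \<le> l2_norm a"
  by (simp add: l2_norm_def infsum_nonneg)

lemma square_summable_mono:
  assumes "square_summable b" and "\<And>i. norm (a i) \<le> norm (b i)"
  shows "square_summable a"
  using assms(1) unfolding square_summable_def
  by (rule summable_on_comparison_test) (simp_all add: assms(2) power_mono)

lemma square_summable_diff:
  assumes "square_summable a" and "square_summable b"
  shows "square_summable (\<lambda>i. a i - b i)"
  unfolding square_summable_def
proof (rule summable_on_comparison_test)
  show "(\<lambda>i. 2 * (norm (a i))\<^sup>2 + 2 * (norm (b i))\<^sup>2) summable_on UNIV"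
    using assms unfolding square_summable_def
    by (intro summable_on_add summable_on_cmult_right)
  show "(norm (a i - b i))\<^sup>2 \<le> 2 * (norm (a i))\<^sup>2 + 2 * (norm (b i))\<^sup>2" for i
  proof -
    have "(norm (a i - b i))\<^sup>2 \<le> (norm (a i) + norm (b i))\<^sup>2"
      by (intro power_mono norm_triangle_ineq4) simp
    also have "\<dots> \<le> 2 * (norm (a i))\<^sup>2 + 2 * (norm (b i))\<^sup>2"
      using sum_squares_bound[of "norm (a i)" "norm (b i)"] by (simp add: power2_sum)
    finally show ?thesis .
  qed
qed simp

lemma square_summable_cmult:
  fixes z :: "'b::real_normed_div_algebra"
  assumes "square_summable a"
  shows "square_summable (\<lambda>i. z * a i)"
  using assms unfolding square_summable_def norm_mult power_mult_distrib
  by (rule summable_on_cmult_right)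

lemma L2_set_le_l2_norm:
  assumes "square_summable a" and "finite I"
  shows "L2_set (\<lambda>i. norm (a i)) I \<le> l2_norm a"
  using assms unfolding L2_set_def l2_norm_def square_summable_def
  by (intro real_sqrt_le_mono finite_sum_le_infsum) auto

lemma l2_norm_mono:
  assumes "square_summable b" and "\<And>i. norm (a i) \<le> norm (b i)"
  shows "l2_norm a \<le> l2_norm b"
  using square_summable_mono[OF assms] assms unfolding square_summable_def l2_norm_def
  by (intro real_sqrt_le_mono infsum_mono power_mono) auto

lemma l2_norm_cmult:
  fixes z :: "'b::real_normed_div_algebra"
  shows "l2_norm (\<lambda>i. z * a i) = norm z * l2_norm a"
  by (simp add: l2_norm_def norm_mult power_mult_distrib infsum_cmult_right' real_sqrt_mult)

lemma tendsto_l2_norm_dominated: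
  fixes a :: "'t \<Rightarrow> 'i \<Rightarrow> 'b::real_normed_vector"
  assumes termwise: "\<And>i. ((\<lambda>t. a t i) \<longlongrightarrow> 0) F"
    and dominated: "\<And>t i. norm (a t i) \<le> norm (b i)" and b_summable: "square_summable b"
  shows "((\<lambda>t. l2_norm (a t)) \<longlongrightarrow> 0) F"
proof -
  have "uniform_limit UNIV (\<lambda>I t. \<Sum>i\<in>I. (norm (a t i))\<^sup>2) (\<lambda>t. \<Sum>\<^sub>\<infinity>i. (norm (a t i))\<^sup>2)
      (finite_subsets_at_top UNIV)"
    using b_summable unfolding square_summable_def
    by (intro Weierstrass_m_test_general) (auto intro: power_mono dominated)
  moreover have "((\<lambda>t. \<Sum>i\<in>I. (norm (a t i))\<^sup>2) \<longlongrightarrow> (\<Sum>i\<in>I. (norm (0::'b))\<^sup>2)) F" for I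
    by (intro tendsto_intros termwise)
  ultimately have "((\<lambda>t. \<Sum>\<^sub>\<infinity>i. (norm (a t i))\<^sup>2) \<longlongrightarrow> 0) F"
    by (intro swap_uniform_limit'[where f = "\<lambda>I t. \<Sum>i\<in>I. (norm (a t i))\<^sup>2" and g = "\<lambda>_. 0"]) auto
  then show ?thesis
    unfolding l2_norm_def using tendsto_real_sqrt by fastforce
qed

section \<open>Bounds on \<open>L\<^sup>p\<close> norms\<close>

definition Lp_norm_le :: "real \<Rightarrow> 'a measure \<Rightarrow> ('a \<Rightarrow> 'b::real_normed_vector) \<Rightarrow> real \<Rightarrow> bool" where
  "Lp_norm_le p M X B \<longleftrightarrow> X \<in> borel_measurable M \<and> 0 \<le> B \<and>
     (\<integral>\<^sup>+ \<omega>. ennreal (norm (X \<omega>) powr p) \<partial>M) \<le> ennreal (B powr p)"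

lemma Lp_norm_leI:
  assumes "X \<in> borel_measurable M" and "0 \<le> B"
    and "(\<integral>\<^sup>+ \<omega>. ennreal (norm (X \<omega>) powr p) \<partial>M) \<le> ennreal (B powr p)"
  shows "Lp_norm_le p M X B"
  using assms by (simp add: Lp_norm_le_def)

lemma Lp_norm_leD:
  assumes "Lp_norm_le p M X B"
  shows "X \<in> borel_measurable M" and "0 \<le> B"
    and "(\<integral>\<^sup>+ \<omega>. ennreal (norm (X \<omega>) powr p) \<partial>M) \<le> ennreal (B powr p)"
  using assms by (simp_all add: Lp_norm_le_def)

lemma Lp_norm_le_mono_AE:
  assumes Y_bound: "Lp_norm_le p M Y B" and X_measurable: "X \<in> borel_measurable M"
    and norm_le: "AE \<omega> in M. norm (X \<omega>) \<le> norm (Y \<omega>)" and p_nonneg: "0 \<le> p"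
  shows "Lp_norm_le p M X B"
proof (rule Lp_norm_leI)
  have "(\<integral>\<^sup>+ \<omega>. ennreal (norm (X \<omega>) powr p) \<partial>M) \<le> (\<integral>\<^sup>+ \<omega>. ennreal (norm (Y \<omega>) powr p) \<partial>M)"
    using norm_le
    by (intro nn_integral_mono_AE) (auto elim!: eventually_mono intro!: powr_mono2 p_nonneg)
  also have "\<dots> \<le> ennreal (B powr p)"
    by (rule Lp_norm_leD[OF Y_bound])
  finally show "(\<integral>\<^sup>+ \<omega>. ennreal (norm (X \<omega>) powr p) \<partial>M) \<le> ennreal (B powr p)" .
qed (use X_measurable Lp_norm_leD[OF Y_bound] in auto)

lemma Lp_norm_le_weaken:
  assumes "Lp_norm_le p M X B" and "B \<le> B'" and "0 \<le> p"
  shows "Lp_norm_le p M X B'"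
  using assms by (auto simp: Lp_norm_le_def intro!: powr_mono2 ennreal_leI elim!: order_trans)

lemma Lp_norm_le_norm_iff:
  assumes "X \<in> borel_measurable M"
  shows "Lp_norm_le p M (\<lambda>\<omega>. norm (X \<omega>)) B \<longleftrightarrow> Lp_norm_le p M X B"
  using assms by (simp add: Lp_norm_le_def)

lemma Lp_norm_le_limit:
  assumes X_bound: "\<And>e. 0 < e \<Longrightarrow> Lp_norm_le p M X (B + e)"
    and B_nonneg: "0 \<le> B" and p_pos: "0 < p"
  shows "Lp_norm_le p M X B"
proof (rule Lp_norm_leI)
  have "((\<lambda>e. (B + e) powr p) \<longlongrightarrow> (B + 0) powr p) (at_right 0)"
    using B_nonneg p_pos by (intro tendsto_powr' tendsto_intros) (auto simp: eventually_at_filter)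
  then have "((\<lambda>e. ennreal ((B + e) powr p)) \<longlongrightarrow> ennreal (B powr p)) (at_right 0)"
    by (intro tendsto_ennrealI) simp
  then show "(\<integral>\<^sup>+ \<omega>. ennreal (norm (X \<omega>) powr p) \<partial>M) \<le> ennreal (B powr p)"
    by (rule tendsto_lowerbound)
       (auto intro!: Lp_norm_leD X_bound eventually_mono[OF eventually_at_right_less])
qed (use B_nonneg Lp_norm_leD(1)[OF X_bound[of 1]] in auto)

lemma Lp_norm_le_cmult:
  fixes z :: "'b::{real_normed_field, second_countable_topology}"
  assumes "Lp_norm_le p M X B"
  shows "Lp_norm_le p M (\<lambda>\<omega>. z * X \<omega>) (norm z * B)"
proof (rule Lp_norm_leI)
  note [measurable] = Lp_norm_leD(1)[OF assms]
  show "(\<lambda>\<omega>. z * X \<omega>) \<in> borel_measurable M"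
    by measurable
  have "(\<integral>\<^sup>+ \<omega>. ennreal (norm (z * X \<omega>) powr p) \<partial>M)
      = ennreal (norm z powr p) * (\<integral>\<^sup>+ \<omega>. ennreal (norm (X \<omega>) powr p) \<partial>M)"
    by (subst nn_integral_cmult[symmetric]) (simp_all add: norm_mult powr_mult ennreal_mult)
  also have "\<dots> \<le> ennreal (norm z powr p) * ennreal (B powr p)"
    by (intro mult_left_mono Lp_norm_leD[OF assms]) simp
  finally show "(\<integral>\<^sup>+ \<omega>. ennreal (norm (z * X \<omega>) powr p) \<partial>M) \<le> ennreal ((norm z * B) powr p)"
    using Lp_norm_leD(2)[OF assms] by (simp add: powr_mult ennreal_mult)
qed (use Lp_norm_leD(2)[OF assms] in simp)

lemma Lp_norm_le_power2_iff:
  assumes "X \<in> borel_measurable M" and "0 \<le> B"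
  shows "Lp_norm_le p M (\<lambda>\<omega>. (norm (X \<omega>))\<^sup>2) (B\<^sup>2) \<longleftrightarrow> Lp_norm_le (2 * p) M X B"
proof -
  have "(u\<^sup>2) powr p = u powr (2 * p)" if "0 \<le> u" for u :: real
    using that by (simp add: powr_powr[symmetric] powr_numeral)
  then show ?thesis
    using assms by (simp add: Lp_norm_le_def)
qed

lemma nn_integral_le_linear_combination:
  assumes [measurable]: "X \<in> borel_measurable M" "Y \<in> borel_measurable M"
    and X_bound: "\<And>\<omega>. 0 \<le> X \<omega>" "(\<integral>\<^sup>+ \<omega>. ennreal (X \<omega>) \<partial>M) \<le> ennreal A"
    and Y_bound: "\<And>\<omega>. 0 \<le> Y \<omega>" "(\<integral>\<^sup>+ \<omega>. ennreal (Y \<omega>) \<partial>M) \<le> ennreal B"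
    and Z_le: "\<And>\<omega>. Z \<omega> \<le> u * X \<omega> + v * Y \<omega>"
    and nonneg: "0 \<le> A" "0 \<le> B" "0 \<le> u" "0 \<le> v"
  shows "(\<integral>\<^sup>+ \<omega>. ennreal (Z \<omega>) \<partial>M) \<le> ennreal (u * A + v * B)"
proof -
  have "(\<integral>\<^sup>+ \<omega>. ennreal (Z \<omega>) \<partial>M)
      \<le> (\<integral>\<^sup>+ \<omega>. ennreal u * ennreal (X \<omega>) + ennreal v * ennreal (Y \<omega>) \<partial>M)"
    using Z_le X_bound(1) Y_bound(1) nonneg
    by (intro nn_integral_mono) (simp flip: ennreal_mult ennreal_plus add: ennreal_leI)
  also have "\<dots> = ennreal u * (\<integral>\<^sup>+ \<omega>. ennreal (X \<omega>) \<partial>M) + ennreal v * (\<integral>\<^sup>+ \<omega>. ennreal (Y \<omega>) \<partial>M)"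
    by (simp add: nn_integral_add nn_integral_cmult)
  also have "\<dots> \<le> ennreal u * ennreal A + ennreal v * ennreal B"
    by (intro add_mono mult_left_mono X_bound Y_bound) simp_all
  also have "\<dots> = ennreal (u * A + v * B)"
    using nonneg by (simp add: ennreal_mult)
  finally show ?thesis .
qed

lemma convex_on_powr_atLeast:
  assumes p_ge_1: "1 \<le> (p::real)"
  shows "convex_on {0..} (\<lambda>x. x powr p)"
proof (rule convex_on_linorderI)
  fix t x y :: real
  assume t_range: "0 < t" "t < 1" and xy_range: "x \<in> {0..}" "y \<in> {0..}" "x < y"
  show "((1 - t) *\<^sub>R x + t *\<^sub>R y) powr p \<le> (1 - t) * x powr p + t * y powr p"
  proof (cases "x = 0")
    case True
    have "t powr p \<le> t"
      using powr_mono'[of 1 p t] t_range p_ge_1 by simp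
    then show ?thesis
      using True t_range xy_range by (simp add: powr_mult mult_right_mono)
  next
    case False
    then show ?thesis
      using convex_onD[OF powr_convex[OF p_ge_1], of t x y] t_range xy_range by simp
  qed
qed simp

lemma powr_add_le_weighted:
  fixes x y A B p :: real
  assumes xy_nonneg: "0 \<le> x" "0 \<le> y" and AB_pos: "0 < A" "0 < B" and p_ge_1: "1 \<le> p"
  defines "S \<equiv> (A + B) powr p"
  shows "(x + y) powr p
    \<le> S * (A / (A + B) / A powr p) * x powr p + S * (B / (A + B) / B powr p) * y powr p"
proof -
  define t where "t = B / (A + B)"
  have t_range: "0 \<le> t" "t \<le> 1" "1 - t = A / (A + B)"
    using AB_pos by (auto simp: t_def field_simps)
  have "x + y = (A + B) * ((1 - t) * (x / A) + t * (y / B))"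
    unfolding t_range(3) using AB_pos by (simp add: t_def flip: add_divide_distrib)
  then have "(x + y) powr p = S * ((1 - t) * (x / A) + t * (y / B)) powr p"
    using AB_pos by (simp add: S_def powr_mult)
  also have "\<dots> \<le> S * ((1 - t) * (x / A) powr p + t * (y / B) powr p)"
    using convex_onD[OF convex_on_powr_atLeast[OF p_ge_1], of t "x / A" "y / B"]
      xy_nonneg AB_pos t_range
    by (intro mult_left_mono) (auto simp: S_def)
  also have "\<dots> = S * (A / (A + B) / A powr p) * x powr p + S * (B / (A + B) / B powr p) * y powr p"
    unfolding t_range(3) using xy_nonneg AB_pos by (simp add: t_def powr_divide algebra_simps)
  finally show ?thesis .
qed

lemma Minkowski_Lp_norm_le_pos:
  fixes X Y :: "'a \<Rightarrow> 'b::{real_normed_vector, second_countable_topology}"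
  assumes X_bound: "Lp_norm_le p M X A" and Y_bound: "Lp_norm_le p M Y B"
    and AB_pos: "0 < A" "0 < B" and p_ge_1: "1 \<le> p"
  shows "Lp_norm_le p M (\<lambda>\<omega>. X \<omega> + Y \<omega>) (A + B)"
proof (rule Lp_norm_leI)
  note [measurable] = Lp_norm_leD(1)[OF X_bound] Lp_norm_leD(1)[OF Y_bound]
  let ?S = "(A + B) powr p"
  let ?u = "?S * (A / (A + B) / A powr p)" and ?v = "?S * (B / (A + B) / B powr p)"
  have "norm (X \<omega> + Y \<omega>) powr p \<le> ?u * norm (X \<omega>) powr p + ?v * norm (Y \<omega>) powr p" for \<omega>
    by (rule order_trans[OF powr_mono2 powr_add_le_weighted])
       (use AB_pos p_ge_1 in \<open>auto intro: norm_triangle_ineq\<close>)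
  then have "(\<integral>\<^sup>+ \<omega>. ennreal (norm (X \<omega> + Y \<omega>) powr p) \<partial>M)
      \<le> ennreal (?u * A powr p + ?v * B powr p)"
    using AB_pos Lp_norm_leD(3)[OF X_bound] Lp_norm_leD(3)[OF Y_bound]
    by (intro nn_integral_le_linear_combination[where X = "\<lambda>\<omega>. norm (X \<omega>) powr p"
          and Y = "\<lambda>\<omega>. norm (Y \<omega>) powr p"]) auto
  also have "?u * A powr p + ?v * B powr p = ?S"
    using AB_pos by (simp add: add_divide_distrib[symmetric] distrib_left[symmetric])
  finally show "(\<integral>\<^sup>+ \<omega>. ennreal (norm (X \<omega> + Y \<omega>) powr p) \<partial>M) \<le> ennreal ((A + B) powr p)" .
  show "(\<lambda>\<omega>. X \<omega> + Y \<omega>) \<in> borel_measurable M"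
    by measurable
qed (use AB_pos in simp)

theorem Minkowski_Lp_norm_le:
  fixes X Y :: "'a \<Rightarrow> 'b::{real_normed_vector, second_countable_topology}"
  assumes X_bound: "Lp_norm_le p M X A" and Y_bound: "Lp_norm_le p M Y B" and p_ge_1: "1 \<le> p"
  shows "Lp_norm_le p M (\<lambda>\<omega>. X \<omega> + Y \<omega>) (A + B)"
proof (rule Lp_norm_le_limit)
  note A_nonneg = Lp_norm_leD(2)[OF X_bound] and B_nonneg = Lp_norm_leD(2)[OF Y_bound]
  show "Lp_norm_le p M (\<lambda>\<omega>. X \<omega> + Y \<omega>) (A + B + e)" if "0 < e" for e
  proof -
    have "Lp_norm_le p M X (A + e / 2)" "Lp_norm_le p M Y (B + e / 2)"
      using X_bound Y_bound that p_ge_1 by (auto intro: Lp_norm_le_weaken)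
    then have "Lp_norm_le p M (\<lambda>\<omega>. X \<omega> + Y \<omega>) (A + e / 2 + (B + e / 2))"
      using A_nonneg B_nonneg that p_ge_1 by (intro Minkowski_Lp_norm_le_pos) auto
    then show ?thesis
      by (simp add: add_ac)
  qed
  show "0 \<le> A + B"
    using A_nonneg B_nonneg by simp
qed (use p_ge_1 in simp)

lemma Lp_norm_le_sum:
  fixes X :: "'i \<Rightarrow> 'a \<Rightarrow> 'b::{real_normed_vector, second_countable_topology}"
  assumes "finite I" and "\<And>i. i \<in> I \<Longrightarrow> Lp_norm_le p M (X i) (B i)" and "1 \<le> p"
  shows "Lp_norm_le p M (\<lambda>\<omega>. \<Sum>i\<in>I. X i \<omega>) (\<Sum>i\<in>I. B i)"
  using assms
  by (induction I) (auto intro: Minkowski_Lp_norm_le Lp_norm_leI)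

lemma Lp_norm_le_L2_set:
  fixes X :: "'i \<Rightarrow> 'a \<Rightarrow> 'b::real_normed_vector"
  assumes finite_I: "finite I" and X_bound: "\<And>i. i \<in> I \<Longrightarrow> Lp_norm_le p M (X i) (B i)"
    and p_ge_2: "2 \<le> p"
  shows "Lp_norm_le p M (\<lambda>\<omega>. L2_set (\<lambda>i. norm (X i \<omega>)) I) (L2_set B I)"
proof -
  have L2_set_power2: "(L2_set u I)\<^sup>2 = (\<Sum>i\<in>I. (u i)\<^sup>2)" for u :: "'i \<Rightarrow> real"
    by (simp add: L2_set_def sum_nonneg)
  have measurable_L2: "(\<lambda>\<omega>. L2_set (\<lambda>i. norm (X i \<omega>)) I) \<in> borel_measurable M"
    unfolding L2_set_def
    by (intro measurable_compose[OF _ borel_measurable_sqrt] borel_measurable_sum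
        borel_measurable_power measurable_compose[OF _ borel_measurable_norm]
        Lp_norm_leD(1)[OF X_bound])
  have "Lp_norm_le (p / 2) M (\<lambda>\<omega>. (norm (X i \<omega>))\<^sup>2) ((B i)\<^sup>2)" if "i \<in> I" for i
    using X_bound[OF that] Lp_norm_leD[OF X_bound[OF that]] by (subst Lp_norm_le_power2_iff) auto
  then have "Lp_norm_le (p / 2) M (\<lambda>\<omega>. \<Sum>i\<in>I. (norm (X i \<omega>))\<^sup>2) (\<Sum>i\<in>I. (B i)\<^sup>2)"
    using p_ge_2 by (intro Lp_norm_le_sum finite_I) auto
  then have "Lp_norm_le (p / 2) M (\<lambda>\<omega>. (norm (L2_set (\<lambda>i. norm (X i \<omega>)) I))\<^sup>2) ((L2_set B I)\<^sup>2)"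
    by (simp add: L2_set_power2)
  then show ?thesis
    using measurable_L2 by (subst (asm) Lp_norm_le_power2_iff) auto
qed

lemma power2_le_ennreal_imp_le:
  assumes "x\<^sup>2 \<le> (ennreal y)\<^sup>2" and "0 \<le> y"
  shows "x \<le> ennreal y"
proof (cases x)
  case (real u)
  then show ?thesis
    using assms by (auto simp: ennreal_power intro!: ennreal_leI power2_le_imp_le)
next
  case top
  then show ?thesis
    using assms by (simp add: ennreal_power top_unique)
qed

theorem Cauchy_Schwarz_Lp_norm_le:
  fixes X Y :: "'a \<Rightarrow> 'b::{real_normed_algebra, second_countable_topology}"
  assumes X_bound: "Lp_norm_le (2 * p) M X A" and Y_bound: "Lp_norm_le (2 * p) M Y B"
    and p_nonneg: "0 \<le> p"
  shows "Lp_norm_le p M (\<lambda>\<omega>. X \<omega> * Y \<omega>) (A * B)"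
proof (rule Lp_norm_leI)
  note [measurable] = Lp_norm_leD(1)[OF X_bound] Lp_norm_leD(1)[OF Y_bound]
  note A_nonneg = Lp_norm_leD(2)[OF X_bound] and B_nonneg = Lp_norm_leD(2)[OF Y_bound]
  have power2_powr: "(ennreal (u powr p))\<^sup>2 = ennreal (u powr (2 * p))" for u
    by (simp add: power2_eq_square flip: ennreal_mult powr_add)
  let ?I = "\<integral>\<^sup>+ \<omega>. ennreal (norm (X \<omega>) powr p) * ennreal (norm (Y \<omega>) powr p) \<partial>M"
  have "?I\<^sup>2 \<le> (\<integral>\<^sup>+ \<omega>. ennreal (norm (X \<omega>) powr (2 * p)) \<partial>M)
      * (\<integral>\<^sup>+ \<omega>. ennreal (norm (Y \<omega>) powr (2 * p)) \<partial>M)"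
    unfolding power2_powr[symmetric] by (intro Cauchy_Schwarz_nn_integral) measurable
  also have "\<dots> \<le> ennreal (A powr (2 * p)) * ennreal (B powr (2 * p))"
    by (intro mult_mono Lp_norm_leD[OF X_bound] Lp_norm_leD[OF Y_bound]) simp_all
  also have "\<dots> = (ennreal ((A * B) powr p))\<^sup>2"
    unfolding power2_powr using A_nonneg B_nonneg by (simp add: powr_mult ennreal_mult)
  finally have product_bound: "?I \<le> ennreal ((A * B) powr p)"
    by (rule power2_le_ennreal_imp_le) simp
  have "(\<integral>\<^sup>+ \<omega>. ennreal (norm (X \<omega> * Y \<omega>) powr p) \<partial>M) \<le> ?I"
    by (intro nn_integral_mono)
       (auto simp flip: ennreal_mult powr_mult
          intro!: ennreal_leI powr_mono2 norm_mult_ineq p_nonneg)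
  with product_bound show "(\<integral>\<^sup>+ \<omega>. ennreal (norm (X \<omega> * Y \<omega>) powr p) \<partial>M) \<le> ennreal ((A * B) powr p)"
    by (rule order_trans[rotated])
  show "(\<lambda>\<omega>. X \<omega> * Y \<omega>) \<in> borel_measurable M"
    by measurable
qed (use Lp_norm_leD(2)[OF X_bound] Lp_norm_leD(2)[OF Y_bound] in simp)

lemma (in sigma_finite_measure) Lp_norm_le_pair_measure:
  assumes X_measurable: "X \<in> borel_measurable (N \<Otimes>\<^sub>M M)"
    and slice_bound: "\<And>u. Lp_norm_le p M (\<lambda>v. X (u, v)) (s u)" and s_bound: "Lp_norm_le p N s B"
  shows "Lp_norm_le p (N \<Otimes>\<^sub>M M) X B"
proof (rule Lp_norm_leI)
  have "(\<integral>\<^sup>+ z. ennreal (norm (X z) powr p) \<partial>(N \<Otimes>\<^sub>M M))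
      = (\<integral>\<^sup>+ u. \<integral>\<^sup>+ v. ennreal (norm (X (u, v)) powr p) \<partial>M \<partial>N)"
    using X_measurable by (intro nn_integral_fst[symmetric]) measurable
  also have "\<dots> \<le> (\<integral>\<^sup>+ u. ennreal (norm (s u) powr p) \<partial>N)"
    using Lp_norm_leD[OF slice_bound] by (intro nn_integral_mono) auto
  also have "\<dots> \<le> ennreal (B powr p)"
    by (rule Lp_norm_leD[OF s_bound])
  finally show "(\<integral>\<^sup>+ z. ennreal (norm (X z) powr p) \<partial>(N \<Otimes>\<^sub>M M)) \<le> ennreal (B powr p)" .
qed (use X_measurable Lp_norm_leD[OF s_bound] in auto)

lemma (in finite_measure) Markov_Lp_norm_le:
  assumes X_bound: "Lp_norm_le p M X B" and p_pos: "0 < p" and l_pos: "0 < l"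
  shows "measure M {\<omega> \<in> space M. l < norm (X \<omega>)} \<le> (B / l) powr p"
proof -
  note [measurable] = Lp_norm_leD(1)[OF X_bound]
  let ?u = "\<lambda>\<omega>. ennreal (norm (X \<omega>) powr p)" and ?c = "ennreal (1 / l powr p)"
  have "1 \<le> ?c * ?u \<omega>" if "l < norm (X \<omega>)" for \<omega>
    using powr_mono2[of p l "norm (X \<omega>)"] that l_pos p_pos
    by (simp add: ennreal_mult[symmetric] ennreal_1[symmetric] del: ennreal_1)
  then have "emeasure M {\<omega> \<in> space M. l < norm (X \<omega>)} \<le> emeasure M {\<omega> \<in> space M. 1 \<le> ?c * ?u \<omega>}"
    by (intro emeasure_mono) auto
  also have "\<dots> \<le> ?c * (\<integral>\<^sup>+ \<omega>. ?u \<omega> * indicator (space M) \<omega> \<partial>M)"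
    by (intro nn_integral_Markov_inequality) auto
  also have "\<dots> \<le> ?c * ennreal (B powr p)"
    using Lp_norm_leD(3)[OF X_bound] by (intro mult_left_mono) (simp_all cong: nn_integral_cong)
  also have "\<dots> = ennreal ((B / l) powr p)"
    using Lp_norm_leD(2)[OF X_bound] l_pos by (simp add: powr_divide flip: ennreal_mult)
  finally show ?thesis
    by (simp add: emeasure_eq_measure)
qed

section \<open>Limits of possibly divergent sequences\<close>

lemma lim0_eq: "X \<longlonglongrightarrow> L \<Longrightarrow> lim0 X = L"
  by (auto simp: lim0_def convergent_def limI)

lemma borel_measurable_lim0 [measurable (raw)]:
  assumes [measurable]: "\<And>n. X n \<in> borel_measurable M"
  shows "(\<lambda>\<omega>. lim0 (\<lambda>n. X n \<omega>)) \<in> borel_measurable M"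
  unfolding lim0_def Cauchy_convergent_iff[symmetric] by measurable

lemma norm_lim0_powr_le_liminf:
  assumes "0 < (p::real)"
  shows "ennreal (norm (lim0 X) powr p) \<le> liminf (\<lambda>n. ennreal (norm (X n) powr p))"
proof (cases "convergent X")
  case True
  then obtain L where X_lim: "X \<longlonglongrightarrow> L"
    by (auto simp: convergent_def)
  then have "(\<lambda>n. ennreal (norm (X n) powr p)) \<longlonglongrightarrow> ennreal (norm L powr p)"
    using assms by (intro tendsto_ennrealI tendsto_powr' tendsto_norm) auto
  then have "liminf (\<lambda>n. ennreal (norm (X n) powr p)) = ennreal (norm L powr p)"
    by (intro lim_imp_Liminf) auto
  then show ?thesis
    by (simp add: lim0_eq[OF X_lim])
qed (simp add: lim0_def)

lemma Lp_norm_le_lim0: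
  assumes X_bound: "\<And>n. Lp_norm_le p M (X n) B" and p_pos: "0 < p"
  shows "Lp_norm_le p M (\<lambda>\<omega>. lim0 (\<lambda>n. X n \<omega>)) B"
proof (rule Lp_norm_leI)
  note [measurable] = Lp_norm_leD(1)[OF X_bound]
  have "(\<integral>\<^sup>+ \<omega>. ennreal (norm (lim0 (\<lambda>n. X n \<omega>)) powr p) \<partial>M)
      \<le> (\<integral>\<^sup>+ \<omega>. liminf (\<lambda>n. ennreal (norm (X n \<omega>) powr p)) \<partial>M)"
    by (intro nn_integral_mono norm_lim0_powr_le_liminf p_pos)
  also have "\<dots> \<le> liminf (\<lambda>n. \<integral>\<^sup>+ \<omega>. ennreal (norm (X n \<omega>) powr p) \<partial>M)"
    by (intro nn_integral_liminf) measurable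
  also have "\<dots> \<le> liminf (\<lambda>n. ennreal (B powr p))"
    by (intro Liminf_mono always_eventually allI Lp_norm_leD X_bound)
  finally show "(\<integral>\<^sup>+ \<omega>. ennreal (norm (lim0 (\<lambda>n. X n \<omega>)) powr p) \<partial>M) \<le> ennreal (B powr p)"
    by (simp add: Liminf_const)
  show "(\<lambda>\<omega>. lim0 (\<lambda>n. X n \<omega>)) \<in> borel_measurable M"
    by measurable
qed (rule Lp_norm_leD[OF X_bound])

section \<open>Series of independent random variables\<close>

lemma summable_if_tail_sums_bounded:
  fixes u :: "nat \<Rightarrow> 'b::banach"
  assumes tails: "\<And>e. 0 < e \<Longrightarrow> \<exists>m. \<forall>k\<ge>m. norm (\<Sum>i\<in>{m..<k}. u i) < e"
  shows "summable u"
  unfolding summable_Cauchy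
proof (intro allI impI)
  fix e :: real assume "0 < e"
  then obtain m where tail_small: "\<And>k. m \<le> k \<Longrightarrow> norm (\<Sum>i\<in>{m..<k}. u i) < e / 2"
    using tails[of "e / 2"] by auto
  have "norm (\<Sum>i\<in>{j..<k}. u i) < e" if "m \<le> j" for j k
  proof (cases "j \<le> k")
    case True
    then have "(\<Sum>i\<in>{j..<k}. u i) = (\<Sum>i\<in>{m..<k}. u i) - (\<Sum>i\<in>{m..<j}. u i)"
      using that by (simp add: sum_diff_nat_ivl)
    also have "norm \<dots> \<le> norm (\<Sum>i\<in>{m..<k}. u i) + norm (\<Sum>i\<in>{m..<j}. u i)"
      by (rule norm_triangle_ineq4)
    finally show ?thesis
      using tail_small[of k] tail_small[of j] that True by simp
  qed (use \<open>0 < e\<close> in simp)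
  then show "\<exists>m. \<forall>j\<ge>m. \<forall>k. norm (\<Sum>i\<in>{j..<k}. u i) < e"
    by blast
qed

lemma (in prob_space) indep_vars_random_variable:
  assumes "indep_vars N X I" and "i \<in> I"
  shows "random_variable (N i) (X i)"
  using assms by (auto simp: indep_vars_def)

definition first_exit :: "real \<Rightarrow> nat \<Rightarrow> nat \<Rightarrow> (nat \<Rightarrow> 'b::real_normed_vector) \<Rightarrow> bool" where
  "first_exit l m k u \<longleftrightarrow>
     l < norm (\<Sum>i\<in>{m..<k}. u i) \<and> (\<forall>j\<in>{m..<k}. norm (\<Sum>i\<in>{m..<j}. u i) \<le> l)"

lemma first_exit_unique:
  assumes "first_exit l m j u" and "first_exit l m k u" and "m \<le> j" and "m \<le> k"
  shows "j = k"
  using assms by (cases j k rule: linorder_cases) (force simp: first_exit_def)+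

lemma first_exit_exists:
  assumes "m \<le> k" and "l < norm (\<Sum>i\<in>{m..<k}. u i)"
  obtains j where "m \<le> j" and "j \<le> k" and "first_exit l m j u"
proof
  define j where "j = (LEAST j. m \<le> j \<and> l < norm (\<Sum>i\<in>{m..<j}. u i))"
  have j_exceeds: "m \<le> j \<and> l < norm (\<Sum>i\<in>{m..<j}. u i)"
    unfolding j_def by (rule LeastI[of _ k]) (use assms in auto)
  show "m \<le> j"
    using j_exceeds by simp
  show "j \<le> k"
    unfolding j_def by (rule Least_le) (use assms in auto)
  show "first_exit l m j u"
    using j_exceeds not_less_Least[of _ "\<lambda>j. m \<le> j \<and> l < norm (\<Sum>i\<in>{m..<j}. u i)"]
    unfolding j_def[symmetric] by (auto simp: first_exit_def not_less)
qed

lemma first_exit_imp_norm_sum_gt: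
  assumes "first_exit (2 * l) m k u" and "norm (\<Sum>i\<in>{k..<n}. u i) \<le> l" and "m \<le> k" and "k \<le> n"
  shows "l < norm (\<Sum>i\<in>{m..<n}. u i)"
proof -
  have "(\<Sum>i\<in>{m..<n}. u i) = (\<Sum>i\<in>{m..<k}. u i) + (\<Sum>i\<in>{k..<n}. u i)"
    using assms by (simp add: sum.atLeastLessThan_concat)
  moreover have "2 * l < norm (\<Sum>i\<in>{m..<k}. u i)"
    using assms by (simp add: first_exit_def)
  ultimately show ?thesis
    using assms(2) norm_diff_ineq[of "\<Sum>i\<in>{m..<k}. u i" "\<Sum>i\<in>{k..<n}. u i"] by simp
qed

lemma first_exit_restrict:
  "first_exit l m k (restrict u {m..<k}) \<longleftrightarrow> first_exit l m k u"
proof -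
  have "(\<Sum>i\<in>{m..<j}. restrict u {m..<k} i) = (\<Sum>i\<in>{m..<j}. u i)" if "j \<le> k" for j
    using that by (intro sum.cong) auto
  then show ?thesis
    by (auto simp: first_exit_def)
qed

lemma pred_first_exit [measurable]:
  "Measurable.pred (PiM {m..<k} (\<lambda>_. borel))
     (first_exit l m k :: (nat \<Rightarrow> 'b::{real_normed_vector, second_countable_topology}) \<Rightarrow> bool)"
proof -
  have [measurable]: "(\<lambda>u. \<Sum>i\<in>{m..<j}. u i)
      \<in> borel_measurable (PiM {m..<k} (\<lambda>_. borel :: 'b measure))" if "j \<le> k" for j
    using that by (intro borel_measurable_sum measurable_component_singleton) auto
  have "Measurable.pred (PiM {m..<k} (\<lambda>_. borel))
      (\<lambda>u :: nat \<Rightarrow> 'b. \<forall>j\<in>{m..<k}. norm (\<Sum>i\<in>{m..<j}. u i) \<le> l)"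
    by (intro pred_intros_finite) auto
  then show ?thesis
    unfolding first_exit_def by measurable
qed

context prob_space
begin

lemma prob_first_exit_inter_increment:
  fixes X :: "nat \<Rightarrow> 'a \<Rightarrow> 'b::{real_normed_vector, second_countable_topology}"
  assumes indep: "indep_vars (\<lambda>_. borel) X UNIV"
  shows "prob {\<omega> \<in> space M. first_exit l m k (\<lambda>i. X i \<omega>) \<and> norm (\<Sum>i\<in>{k..<n}. X i \<omega>) \<le> h}
    = prob {\<omega> \<in> space M. first_exit l m k (\<lambda>i. X i \<omega>)}
      * prob {\<omega> \<in> space M. norm (\<Sum>i\<in>{k..<n}. X i \<omega>) \<le> h}"
proof -
  let ?P = "PiM {m..<k} (\<lambda>_. borel :: 'b measure)" and ?Q = "PiM {k..<n} (\<lambda>_. borel :: 'b measure)"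
  let ?E = "{u \<in> space ?P. first_exit l m k u}"
  let ?F = "{u \<in> space ?Q. norm (\<Sum>i\<in>{k..<n}. u i) \<le> h}"
  have "indep_var ?P (\<lambda>\<omega>. restrict (\<lambda>i. X i \<omega>) {m..<k}) ?Q (\<lambda>\<omega>. restrict (\<lambda>i. X i \<omega>) {k..<n})"
    by (intro indep_var_restrict[OF indep]) auto
  from indep_varD[OF this, of ?E ?F] show ?thesis
    by (simp add: vimage_def space_PiM first_exit_restrict Collect_conj_eq Int_ac cong: conj_cong)
qed

theorem Ottaviani_inequality:
  fixes X :: "nat \<Rightarrow> 'a \<Rightarrow> 'b::{real_normed_vector, second_countable_topology}"
  assumes indep: "indep_vars (\<lambda>_. borel) X UNIV"
    and increments: "\<And>k. m \<le> k \<Longrightarrow> k \<le> n \<Longrightarrow>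
      prob {\<omega> \<in> space M. l < norm (\<Sum>i\<in>{k..<n}. X i \<omega>)} \<le> 1 / 2"
  shows "prob {\<omega> \<in> space M. \<exists>k\<in>{m..n}. 2 * l < norm (\<Sum>i\<in>{m..<k}. X i \<omega>)}
    \<le> 2 * prob {\<omega> \<in> space M. l < norm (\<Sum>i\<in>{m..<n}. X i \<omega>)}"
proof -
  note [measurable] = indep_vars_random_variable[OF indep UNIV_I]
  define E where "E k = {\<omega> \<in> space M. first_exit (2 * l) m k (\<lambda>i. X i \<omega>)}" for k
  define D where "D k = {\<omega> \<in> space M. norm (\<Sum>i\<in>{k..<n}. X i \<omega>) \<le> l}" for k
  have [measurable]: "E k \<in> sets M" "D k \<in> sets M" for k
    unfolding E_def D_def first_exit_def by measurable
  have disjoint_E: "disjoint_family_on E {m..n}"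
    unfolding disjoint_family_on_def E_def using first_exit_unique by fastforce
  have prob_E_le: "prob (E k) \<le> 2 * prob (E k \<inter> D k)" if "k \<in> {m..n}" for k
  proof -
    have "prob (D k) = 1 - prob {\<omega> \<in> space M. l < norm (\<Sum>i\<in>{k..<n}. X i \<omega>)}"
      unfolding D_def by (subst prob_neg[symmetric]) (auto simp: not_less)
    then have "prob (E k) * (1 / 2) \<le> prob (E k) * prob (D k)"
      using increments[of k] that by (intro mult_left_mono) auto
    also have "\<dots> = prob (E k \<inter> D k)"
      using prob_first_exit_inter_increment[OF indep, of "2 * l" m k n l]
      by (simp add: E_def D_def Collect_conj_eq Int_ac)
    finally show ?thesis
      by simp
  qed
  have "{\<omega> \<in> space M. \<exists>k\<in>{m..n}. 2 * l < norm (\<Sum>i\<in>{m..<k}. X i \<omega>)} \<subseteq> (\<Union>k\<in>{m..n}. E k)"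
    by (force simp: E_def elim!: first_exit_exists[rotated])
  then have "prob {\<omega> \<in> space M. \<exists>k\<in>{m..n}. 2 * l < norm (\<Sum>i\<in>{m..<k}. X i \<omega>)}
      \<le> prob (\<Union>k\<in>{m..n}. E k)"
    by (intro finite_measure_mono) auto
  also have "\<dots> = (\<Sum>k\<in>{m..n}. prob (E k))"
    by (intro finite_measure_finite_Union disjoint_E) auto
  also have "\<dots> \<le> (\<Sum>k\<in>{m..n}. 2 * prob (E k \<inter> D k))"
    by (rule sum_mono) (rule prob_E_le)
  also have "\<dots> = 2 * prob (\<Union>k\<in>{m..n}. E k \<inter> D k)"
    using disjoint_E unfolding sum_distrib_left[symmetric]
    by (subst finite_measure_finite_Union) (auto simp: disjoint_family_on_def)
  also have "\<dots> \<le> 2 * prob {\<omega> \<in> space M. l < norm (\<Sum>i\<in>{m..<n}. X i \<omega>)}"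
    by (intro mult_left_mono finite_measure_mono)
       (auto simp: E_def D_def intro: first_exit_imp_norm_sum_gt)
  finally show ?thesis .
qed

lemma prob_tail_exceeds_le:
  fixes X :: "nat \<Rightarrow> 'a \<Rightarrow> 'b::{real_normed_vector, second_countable_topology}"
  assumes indep: "indep_vars (\<lambda>_. borel) X UNIV" and e_le_half: "e \<le> 1 / 2"
    and increments: "\<And>j k. m \<le> j \<Longrightarrow> prob {\<omega> \<in> space M. l < norm (\<Sum>i\<in>{j..<k}. X i \<omega>)} \<le> e"
  shows "prob {\<omega> \<in> space M. \<exists>k\<ge>m. 2 * l < norm (\<Sum>i\<in>{m..<k}. X i \<omega>)} \<le> 2 * e"
proof -
  note [measurable] = indep_vars_random_variable[OF indep UNIV_I]
  let ?E = "\<lambda>n. {\<omega> \<in> space M. \<exists>k\<in>{m..n}. 2 * l < norm (\<Sum>i\<in>{m..<k}. X i \<omega>)}"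
  have "(\<lambda>n. prob (?E n)) \<longlonglongrightarrow> prob (\<Union>n. ?E n)"
    by (intro finite_Lim_measure_incseq) (auto simp: incseq_def)
  moreover have "prob (?E n) \<le> 2 * e" for n
    using Ottaviani_inequality[OF indep, of m n l] increments[of _ n] e_le_half
    by (meson order_refl order_trans mult_left_mono zero_le_numeral)
  ultimately have "prob (\<Union>n. ?E n) \<le> 2 * e"
    by (intro LIMSEQ_le_const2) auto
  also have "(\<Union>n. ?E n) = {\<omega> \<in> space M. \<exists>k\<ge>m. 2 * l < norm (\<Sum>i\<in>{m..<k}. X i \<omega>)}"
    by fastforce
  finally show ?thesis .
qed

lemma AE_exists_tail_bounded:
  fixes X :: "nat \<Rightarrow> 'a \<Rightarrow> 'b::{real_normed_vector, second_countable_topology}"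
  assumes indep: "indep_vars (\<lambda>_. borel) X UNIV"
    and Cauchy: "\<And>e. 0 < e \<Longrightarrow> \<exists>m. \<forall>j\<ge>m. \<forall>k.
      prob {\<omega> \<in> space M. l < norm (\<Sum>i\<in>{j..<k}. X i \<omega>)} \<le> e"
  shows "AE \<omega> in M. \<exists>m. \<forall>k\<ge>m. norm (\<Sum>i\<in>{m..<k}. X i \<omega>) \<le> 2 * l"
proof -
  note [measurable] = indep_vars_random_variable[OF indep UNIV_I]
  define E where "E m = {\<omega> \<in> space M. \<exists>k\<ge>m. 2 * l < norm (\<Sum>i\<in>{m..<k}. X i \<omega>)}" for m
  have [measurable]: "E m \<in> sets M" for m
    unfolding E_def by measurable
  have "prob (\<Inter>m. E m) \<le> 0 + e" if "0 < e" for e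
  proof -
    obtain m where "\<And>j k. m \<le> j \<Longrightarrow>
        prob {\<omega> \<in> space M. l < norm (\<Sum>i\<in>{j..<k}. X i \<omega>)} \<le> min (1 / 2) (e / 2)"
      using Cauchy[of "min (1 / 2) (e / 2)"] \<open>0 < e\<close> by auto
    then have "prob (E m) \<le> 2 * min (1 / 2) (e / 2)"
      unfolding E_def by (intro prob_tail_exceeds_le[OF indep]) auto
    moreover have "prob (\<Inter>m. E m) \<le> prob (E m)"
      by (intro finite_measure_mono) auto
    ultimately show ?thesis
      by linarith
  qed
  then have "prob (\<Inter>m. E m) \<le> 0"
    by (rule field_le_epsilon)
  then have "AE \<omega> in M. \<omega> \<notin> (\<Inter>m. E m)"
    by (subst prob_eq_0[symmetric]) (auto simp: measure_le_0_iff)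
  with AE_space show ?thesis
    by eventually_elim (auto simp: E_def not_less)
qed

theorem AE_summable_indep_vars:
  fixes X :: "nat \<Rightarrow> 'a \<Rightarrow> 'b::{banach, second_countable_topology}"
  assumes indep: "indep_vars (\<lambda>_. borel) X UNIV"
    and Cauchy: "\<And>l e. 0 < l \<Longrightarrow> 0 < e \<Longrightarrow> \<exists>m. \<forall>j\<ge>m. \<forall>k.
      prob {\<omega> \<in> space M. l < norm (\<Sum>i\<in>{j..<k}. X i \<omega>)} \<le> e"
  shows "AE \<omega> in M. summable (\<lambda>i. X i \<omega>)"
proof -
  have "AE \<omega> in M. \<forall>p. \<exists>m. \<forall>k\<ge>m. norm (\<Sum>i\<in>{m..<k}. X i \<omega>) \<le> 2 * inverse (real (Suc p))"
    by (intro AE_all_countable[THEN iffD2] allI AE_exists_tail_bounded[OF indep] Cauchy) auto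
  then show ?thesis
  proof eventually_elim
    case (elim \<omega>)
    show ?case
    proof (rule summable_if_tail_sums_bounded)
      fix e :: real assume "0 < e"
      then obtain p where p_small: "inverse (real (Suc p)) < e / 2"
        using reals_Archimedean[of "e / 2"] by auto
      obtain m where "\<forall>k\<ge>m. norm (\<Sum>i\<in>{m..<k}. X i \<omega>) \<le> 2 * inverse (real (Suc p))"
        using elim by blast
      with p_small show "\<exists>m. \<forall>k\<ge>m. norm (\<Sum>i\<in>{m..<k}. X i \<omega>) < e"
        by (intro exI[of _ m]) fastforce
    qed
  qed
qed

end

section \<open>Subgaussian series\<close>

lemma powr_le_exp:
  fixes y r b :: real
  assumes "0 \<le> y" "0 < r" "0 < b"
  shows "y powr r \<le> (r / (exp 1 * b)) powr r * exp (b * y)"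
proof (cases "y = 0")
  case False
  with assms have y_pos: "y > 0"
    by simp
  have "ln (b * y / r) \<le> b * y / r - 1"
    using assms y_pos by (intro ln_le_minus_one) simp
  then have "r * ln (b * y / r) \<le> b * y - r"
    using assms by (simp add: field_simps)
  then have "r * ln y \<le> r * ln (r / (exp 1 * b)) + b * y"
    using assms y_pos by (simp add: ln_mult ln_div algebra_simps)
  then have "exp (r * ln y) \<le> exp (r * ln (r / (exp 1 * b)) + b * y)"
    by simp
  then show ?thesis
    using assms y_pos by (simp add: powr_def exp_add)
qed simp

lemma abs_powr_le_exp_add_exp:
  fixes y r b :: real
  assumes "0 < r" "0 < b"
  defines "q \<equiv> (r / (exp 1 * b)) powr r"
  shows "\<bar>y\<bar> powr r \<le> q * exp (b * y) + q * exp (- b * y)"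
proof -
  have "\<bar>y\<bar> powr r \<le> q * exp (b * \<bar>y\<bar>)"
    unfolding q_def using assms by (intro powr_le_exp) auto
  also have "\<dots> \<le> q * (exp (b * y) + exp (- b * y))"
    by (intro mult_left_mono) (auto simp: abs_if q_def)
  finally show ?thesis
    by (simp add: distrib_left)
qed

lemma subgaussian_moment_le:
  fixes r s c :: real
  assumes r_ge_1: "1 \<le> r" and s_pos: "0 < s"
  shows "2 * ((r / (exp 1 * (sqrt r / s))) powr r * exp (c * r)) \<le> (2 * exp c * sqrt r * s) powr r"
proof -
  have "r / (exp 1 * (sqrt r / s)) = sqrt r * s / exp 1"
    using s_pos r_ge_1 by (simp add: field_simps)
  also have "\<dots> \<le> sqrt r * s"
    using s_pos r_ge_1 mult_left_mono[of 1 "exp 1" "sqrt r * s"] by (simp add: divide_le_eq)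
  finally have "(r / (exp 1 * (sqrt r / s))) powr r \<le> (sqrt r * s) powr r"
    using r_ge_1 s_pos by (intro powr_mono2) auto
  moreover have "(2::real) \<le> 2 powr r"
    using powr_mono[of 1 r 2] r_ge_1 by simp
  ultimately have "2 * ((r / (exp 1 * (sqrt r / s))) powr r * exp (c * r))
      \<le> 2 powr r * ((sqrt r * s) powr r * exp (c * r))"
    by (intro mult_mono) auto
  also have "\<dots> = (2 * exp c * sqrt r * s) powr r"
    using s_pos r_ge_1 by (simp add: powr_mult exp_powr_real mult_ac)
  finally show ?thesis .
qed

lemma abs_diff_norm_power2_le:
  fixes z w :: "'b::real_normed_vector"
  shows "\<bar>(norm z)\<^sup>2 - (norm w)\<^sup>2\<bar> \<le> (norm z + norm w) * norm (z - w)"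
  using norm_triangle_ineq3[of z w]
  by (simp add: power2_eq_square square_diff_square_factored abs_mult mult_left_mono)

definition khinchine_const :: "real \<Rightarrow> real" where
  "khinchine_const c = 4 * exp c"

lemma khinchine_const_pos: "0 < khinchine_const c"
  by (simp add: khinchine_const_def)

lemma sum_UN_disjoint_family:
  assumes "disjoint_family D" and "\<And>n. finite (D n)" and "finite J"
  shows "(\<Sum>n\<in>J. \<Sum>i\<in>D n. h i) = sum h (\<Union>n\<in>J. D n)"
  using assms by (intro sum.UNION_disjoint[symmetric]) (auto simp: disjoint_family_on_def)

lemma summable_sum_disjoint_family:
  fixes h :: "'i \<Rightarrow> real" and D :: "nat \<Rightarrow> 'i set"
  assumes h_summable: "h summable_on UNIV" "\<And>i. 0 \<le> h i"
    and D_disjoint: "disjoint_family D" "\<And>n. finite (D n)"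
  shows "summable (\<lambda>n. \<Sum>i\<in>D n. h i)"
proof (rule summableI_nonneg_bounded)
  show "(\<Sum>n<N. \<Sum>i\<in>D n. h i) \<le> infsum h UNIV" for N
    unfolding sum_UN_disjoint_family[OF D_disjoint finite_lessThan]
    using h_summable D_disjoint by (intro finite_sum_le_infsum) auto
qed (use h_summable in \<open>auto intro: sum_nonneg\<close>)

locale indep_subgaussian = prob_space M for M :: "'a measure" +
  fixes g :: "'i \<Rightarrow> 'a \<Rightarrow> real" and c :: real
  assumes indep: "indep_vars (\<lambda>_. borel) g UNIV"
    and mgf_le: "\<And>i \<gamma>. (\<integral>\<^sup>+ \<omega>. ennreal (exp (\<gamma> * g i \<omega>)) \<partial>M) \<le> ennreal (exp (c * \<gamma>\<^sup>2))"
begin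

lemma g_measurable [measurable]: "g i \<in> borel_measurable M"
  using indep_vars_random_variable[OF indep UNIV_I] .

lemma mgf_sum_le:
  assumes "finite I"
  shows "(\<integral>\<^sup>+ \<omega>. ennreal (exp (\<gamma> * (\<Sum>i\<in>I. g i \<omega> * a i))) \<partial>M)
    \<le> ennreal (exp (c * (\<gamma> * L2_set a I)\<^sup>2))"
proof -
  have indep_exp: "indep_vars (\<lambda>_. borel) (\<lambda>i \<omega>. ennreal (exp (\<gamma> * a i * g i \<omega>))) I"
    by (rule indep_vars_compose2[OF indep_vars_subset[OF indep],
          where Y = "\<lambda>i x. ennreal (exp (\<gamma> * a i * x))"]) auto
  have "(\<integral>\<^sup>+ \<omega>. ennreal (exp (\<gamma> * (\<Sum>i\<in>I. g i \<omega> * a i))) \<partial>M)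
      = (\<integral>\<^sup>+ \<omega>. (\<Prod>i\<in>I. ennreal (exp (\<gamma> * a i * g i \<omega>))) \<partial>M)"
    by (intro nn_integral_cong)
       (simp add: sum_distrib_left exp_sum[OF assms] prod_ennreal mult_ac)
  also have "\<dots> = (\<Prod>i\<in>I. \<integral>\<^sup>+ \<omega>. ennreal (exp (\<gamma> * a i * g i \<omega>)) \<partial>M)"
    by (rule indep_vars_nn_integral[OF assms indep_exp]) simp
  also have "\<dots> \<le> (\<Prod>i\<in>I. ennreal (exp (c * (\<gamma> * a i)\<^sup>2)))"
    using assms by (induction I) (auto intro!: mult_mono mgf_le)
  also have "\<dots> = ennreal (exp (c * (\<gamma>\<^sup>2 * (\<Sum>i\<in>I. (a i)\<^sup>2))))"
    by (simp add: prod_ennreal exp_sum[OF assms] sum_distrib_left power_mult_distrib)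
  also have "\<gamma>\<^sup>2 * (\<Sum>i\<in>I. (a i)\<^sup>2) = (\<gamma> * L2_set a I)\<^sup>2"
    by (simp add: L2_set_def power_mult_distrib sum_nonneg)
  finally show ?thesis .
qed

theorem Khinchine_inequality_real:
  assumes finite_I: "finite I" and r_ge_1: "1 \<le> r"
  shows "Lp_norm_le r M (\<lambda>\<omega>. \<Sum>i\<in>I. g i \<omega> * a i) (2 * exp c * sqrt r * L2_set a I)"
proof (cases "L2_set a I = 0")
  case True
  then show ?thesis
    using finite_I r_ge_1 by (simp add: L2_set_eq_0_iff Lp_norm_le_def)
next
  case False
  define s where "s = L2_set a I"
  have s_pos: "0 < s"
    using False by (simp add: s_def less_le)
  \<comment> \<open>This choice turns the bound \<open>exp (c (b s)\<^sup>2)\<close> on the moment generating function into the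
    \<open>r\<close>-th power of a constant.\<close>
  define b where "b = sqrt r / s"
  have b_choice: "0 < b" "(b * s)\<^sup>2 = r"
    using s_pos r_ge_1 by (auto simp: b_def)
  let ?X = "\<lambda>\<omega>. \<Sum>i\<in>I. g i \<omega> * a i" and ?q = "(r / (exp 1 * b)) powr r"
  have "\<bar>?X \<omega>\<bar> powr r \<le> ?q * exp (b * ?X \<omega>) + ?q * exp (- b * ?X \<omega>)" for \<omega>
    using r_ge_1 b_choice by (intro abs_powr_le_exp_add_exp) auto
  then have "(\<integral>\<^sup>+ \<omega>. ennreal (\<bar>?X \<omega>\<bar> powr r) \<partial>M) \<le> ennreal (?q * exp (c * r) + ?q * exp (c * r))"
    using mgf_sum_le[OF finite_I, of b a] mgf_sum_le[OF finite_I, of "- b" a] b_choice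
    by (intro nn_integral_le_linear_combination[where X = "\<lambda>\<omega>. exp (b * ?X \<omega>)"
          and Y = "\<lambda>\<omega>. exp (- b * ?X \<omega>)"]) (simp_all flip: s_def)
  also have "?q * exp (c * r) + ?q * exp (c * r) \<le> (2 * exp c * sqrt r * s) powr r"
    unfolding b_def using subgaussian_moment_le[OF r_ge_1 s_pos, of c] by linarith
  finally show ?thesis
    using s_pos r_ge_1 by (intro Lp_norm_leI) (auto simp: s_def ennreal_leI)
qed

theorem Khinchine_inequality:
  fixes a :: "'i \<Rightarrow> complex"
  assumes finite_I: "finite I" and r_ge_1: "1 \<le> r"
  shows "Lp_norm_le r M (\<lambda>\<omega>. \<Sum>i\<in>I. of_real (g i \<omega>) * a i)
    (khinchine_const c * sqrt r * L2_set (\<lambda>i. cmod (a i)) I)"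
proof -
  let ?S = "\<lambda>u \<omega>. \<Sum>i\<in>I. g i \<omega> * u (a i)"
  let ?B = "2 * exp c * sqrt r * L2_set (\<lambda>i. cmod (a i)) I"
  have part_bound: "Lp_norm_le r M (\<lambda>\<omega>. norm (?S u \<omega>)) ?B" if "\<And>z. \<bar>u z\<bar> \<le> cmod z" for u
  proof -
    have "L2_set (\<lambda>i. u (a i)) I \<le> L2_set (\<lambda>i. cmod (a i)) I"
      unfolding L2_set_def using that
      by (intro real_sqrt_le_mono sum_mono abs_le_square_iff[THEN iffD1]) auto
    then have "2 * exp c * sqrt r * L2_set (\<lambda>i. u (a i)) I \<le> ?B"
      using r_ge_1 by (intro mult_left_mono) auto
    then have "Lp_norm_le r M (?S u) ?B"
      using r_ge_1
      by (intro Lp_norm_le_weaken[OF Khinchine_inequality_real[OF finite_I r_ge_1]]) auto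
    then show ?thesis
      by (subst Lp_norm_le_norm_iff) auto
  qed
  have "Lp_norm_le r M (\<lambda>\<omega>. norm (?S Re \<omega>) + norm (?S Im \<omega>)) (?B + ?B)"
    by (intro Minkowski_Lp_norm_le part_bound abs_Re_le_cmod abs_Im_le_cmod r_ge_1)
  also have "?B + ?B = khinchine_const c * sqrt r * L2_set (\<lambda>i. cmod (a i)) I"
    by (simp add: khinchine_const_def)
  finally show ?thesis
  proof (rule Lp_norm_le_mono_AE)
    have "cmod (\<Sum>i\<in>I. of_real (g i \<omega>) * a i) \<le> \<bar>?S Re \<omega>\<bar> + \<bar>?S Im \<omega>\<bar>" for \<omega>
      using cmod_le[of "\<Sum>i\<in>I. of_real (g i \<omega>) * a i"] by (simp add: Re_sum Im_sum)
    then show "AE \<omega> in M. cmod (\<Sum>i\<in>I. of_real (g i \<omega>) * a i)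
        \<le> norm (norm (?S Re \<omega>) + norm (?S Im \<omega>))"
      by simp
  qed (use r_ge_1 in auto)
qed

lemma Lp_norm_le_rand_sum_pair_measure:
  fixes Z :: "'i \<Rightarrow> 'u \<Rightarrow> complex"
  assumes finite_I: "finite I" and Z_bound: "\<And>i. i \<in> I \<Longrightarrow> Lp_norm_le r N (Z i) (B i)"
    and r_ge_2: "2 \<le> r"
  shows "Lp_norm_le r (N \<Otimes>\<^sub>M M) (\<lambda>p. \<Sum>i\<in>I. of_real (g i (snd p)) * Z i (fst p))
    (khinchine_const c * sqrt r * L2_set B I)"
proof (rule Lp_norm_le_pair_measure)
  show "(\<lambda>p. \<Sum>i\<in>I. of_real (g i (snd p)) * Z i (fst p)) \<in> borel_measurable (N \<Otimes>\<^sub>M M)"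
  proof (rule borel_measurable_sum)
    fix i assume "i \<in> I"
    note [measurable] = Lp_norm_leD(1)[OF Z_bound[OF this]]
    show "(\<lambda>p. of_real (g i (snd p)) * Z i (fst p)) \<in> borel_measurable (N \<Otimes>\<^sub>M M)"
      by measurable
  qed
  show "Lp_norm_le r M (\<lambda>v. \<Sum>i\<in>I. of_real (g i (snd (u, v))) * Z i (fst (u, v)))
      (khinchine_const c * sqrt r * L2_set (\<lambda>i. cmod (Z i u)) I)" for u
    using Khinchine_inequality[OF finite_I] r_ge_2 by simp
  have "0 \<le> khinchine_const c * sqrt r"
    using khinchine_const_pos[of c] r_ge_2 by simp
  then show "Lp_norm_le r N (\<lambda>u. khinchine_const c * sqrt r * L2_set (\<lambda>i. cmod (Z i u)) I)
      (khinchine_const c * sqrt r * L2_set B I)"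
    using Lp_norm_le_cmult[OF Lp_norm_le_L2_set[OF finite_I Z_bound r_ge_2],
        where z = "khinchine_const c * sqrt r"] by simp
qed

lemma prob_sum_exceeds_le:
  fixes a :: "'i \<Rightarrow> complex"
  assumes finite_I: "finite I" and l_pos: "0 < l"
  shows "prob {\<omega> \<in> space M. l < cmod (\<Sum>i\<in>I. of_real (g i \<omega>) * a i)}
    \<le> 2 * (khinchine_const c)\<^sup>2 / l\<^sup>2 * (\<Sum>i\<in>I. (cmod (a i))\<^sup>2)"
proof -
  have "prob {\<omega> \<in> space M. l < cmod (\<Sum>i\<in>I. of_real (g i \<omega>) * a i)}
      \<le> (khinchine_const c * sqrt 2 * L2_set (\<lambda>i. cmod (a i)) I / l) powr 2"
    using finite_I l_pos by (intro Markov_Lp_norm_le Khinchine_inequality) auto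
  also have "\<dots> = 2 * (khinchine_const c)\<^sup>2 / l\<^sup>2 * (\<Sum>i\<in>I. (cmod (a i))\<^sup>2)"
    using l_pos khinchine_const_pos[of c]
    by (simp add: L2_set_def power_divide power_mult_distrib sum_nonneg)
  finally show ?thesis .
qed

lemma indep_vars_block_sums:
  fixes a :: "'i \<Rightarrow> complex" and D :: "nat \<Rightarrow> 'i set"
  assumes "disjoint_family D"
  shows "indep_vars (\<lambda>_. borel) (\<lambda>n \<omega>. \<Sum>i\<in>D n. of_real (g i \<omega>) * a i) UNIV"
proof -
  have "indep_vars (\<lambda>n. PiM (D n) (\<lambda>_. borel)) (\<lambda>n \<omega>. restrict (\<lambda>i. g i \<omega>) (D n)) UNIV"
    using assms by (intro indep_vars_restrict[OF indep]) auto
  then have "indep_vars (\<lambda>_. borel)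
      (\<lambda>n \<omega>. (\<lambda>u. \<Sum>i\<in>D n. of_real (u i) * a i) (restrict (\<lambda>i. g i \<omega>) (D n))) UNIV"
    by (rule indep_vars_compose2)
       (auto intro!: borel_measurable_sum borel_measurable_times borel_measurable_of_real
          measurable_component_singleton)
  then show ?thesis
    by (simp cong: sum.cong)
qed

theorem AE_summable_block_sums:
  fixes a :: "'i \<Rightarrow> complex" and D :: "nat \<Rightarrow> 'i set"
  assumes a_summable: "square_summable a" and D_disjoint: "disjoint_family D" "\<And>n. finite (D n)"
  shows "AE \<omega> in M. summable (\<lambda>n. \<Sum>i\<in>D n. of_real (g i \<omega>) * a i)"
proof (rule AE_summable_indep_vars[OF indep_vars_block_sums[OF D_disjoint(1)]])
  define v where "v n = (\<Sum>i\<in>D n. (cmod (a i))\<^sup>2)" for n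
  have "summable v"
    unfolding v_def using a_summable D_disjoint
    by (intro summable_sum_disjoint_family) (auto simp: square_summable_def)
  fix l e :: real assume l_pos: "0 < l" and e_pos: "0 < e"
  define K where "K = 2 * (khinchine_const c)\<^sup>2 / l\<^sup>2"
  have K_pos: "0 < K"
    using l_pos khinchine_const_pos[of c] by (simp add: K_def)
  then have "0 < e / K"
    using e_pos by simp
  then obtain m where tail_small: "\<And>j k. m \<le> j \<Longrightarrow> (\<Sum>n\<in>{j..<k}. v n) < e / K"
    using \<open>summable v\<close> unfolding summable_Cauchy real_norm_def abs_less_iff by blast
  let ?E = "\<lambda>j k. {\<omega> \<in> space M. l < norm (\<Sum>n\<in>{j..<k}. \<Sum>i\<in>D n. of_real (g i \<omega>) * a i)}"
  have "prob (?E j k) \<le> e" if "m \<le> j" for j k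
  proof -
    have "prob (?E j k) \<le> K * (\<Sum>n\<in>{j..<k}. v n)"
      unfolding v_def K_def sum_UN_disjoint_family[OF D_disjoint finite_atLeastLessThan]
      using D_disjoint(2) l_pos by (intro prob_sum_exceeds_le) auto
    also have "\<dots> \<le> e"
      using tail_small[OF that, of k] K_pos by (simp add: field_simps)
    finally show ?thesis .
  qed
  then show "\<exists>m. \<forall>j\<ge>m. \<forall>k. prob (?E j k) \<le> e"
    by blast
qed

end

locale subgaussian_series = indep_subgaussian M g c
  for M :: "'a measure" and g :: "'i \<Rightarrow> 'a \<Rightarrow> real" and c :: real +
  fixes A :: "nat \<Rightarrow> 'i set"
  assumes incseq_A: "incseq A" and finite_A: "\<And>n. finite (A n)"
begin

definition rand_series :: "('i \<Rightarrow> complex) \<Rightarrow> 'a \<Rightarrow> complex" where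
  "rand_series a \<omega> = lim0 (\<lambda>n. \<Sum>i\<in>A n. of_real (g i \<omega>) * a i)"

lemma Lp_norm_le_rand_series:
  assumes a_summable: "square_summable a" and r_ge_1: "1 \<le> r"
  shows "Lp_norm_le r M (rand_series a) (khinchine_const c * sqrt r * l2_norm a)"
  unfolding rand_series_def
proof (rule Lp_norm_le_lim0)
  show "Lp_norm_le r M (\<lambda>\<omega>. \<Sum>i\<in>A n. of_real (g i \<omega>) * a i)
      (khinchine_const c * sqrt r * l2_norm a)" for n
    using r_ge_1 khinchine_const_pos[of c]
    by (intro Lp_norm_le_weaken[OF Khinchine_inequality] mult_left_mono L2_set_le_l2_norm
        a_summable finite_A) auto
qed (use r_ge_1 in simp)

lemma finite_disjointed_A: "finite (disjointed A n)"
  using finite_A disjointed_subset by (rule finite_subset[rotated])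

lemma sum_disjointed: "(\<Sum>n<Suc N. \<Sum>i\<in>disjointed A n. h i) = (\<Sum>i\<in>A N. h i)"
proof (induction N)
  case (Suc N)
  have "A (Suc N) = A N \<union> disjointed A (Suc N)" "A N \<inter> disjointed A (Suc N) = {}"
    using incseq_SucD[OF incseq_A, of N] incseq_A by (auto simp: disjointed_mono)
  then have "(\<Sum>i\<in>A (Suc N). h i) = (\<Sum>i\<in>A N. h i) + (\<Sum>i\<in>disjointed A (Suc N). h i)"
    using finite_A finite_disjointed_A by (simp add: sum.union_disjoint)
  with Suc show ?case
    by simp
qed simp

theorem AE_convergent_rand_series:
  fixes a :: "'i \<Rightarrow> complex"
  assumes a_summable: "square_summable a"
  shows "AE \<omega> in M. convergent (\<lambda>n. \<Sum>i\<in>A n. of_real (g i \<omega>) * a i)"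
  using AE_summable_block_sums[OF a_summable disjoint_family_disjointed finite_disjointed_A]
proof eventually_elim
  case (elim \<omega>)
  then have "convergent (\<lambda>N. \<Sum>n<Suc N. \<Sum>i\<in>disjointed A n. of_real (g i \<omega>) * a i)"
    by (subst convergent_Suc_iff) (simp add: summable_iff_convergent)
  then show ?case
    unfolding sum_disjointed .
qed

text \<open>Almost sure convergence is needed here: where only one of the two series converges, the
  series of the differences diverges and has the junk value 0.\<close>
lemma AE_rand_series_diff:
  assumes "square_summable a" and "square_summable b"
  shows "AE \<omega> in M. rand_series a \<omega> - rand_series b \<omega> = rand_series (\<lambda>i. a i - b i) \<omega>"
  using AE_convergent_rand_series[OF assms(1)] AE_convergent_rand_series[OF assms(2)]
proof eventually_elim
  case (elim \<omega>)
  then obtain u v where limits: "(\<lambda>n. \<Sum>i\<in>A n. of_real (g i \<omega>) * a i) \<longlonglongrightarrow> u"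
      "(\<lambda>n. \<Sum>i\<in>A n. of_real (g i \<omega>) * b i) \<longlonglongrightarrow> v"
    by (auto simp: convergent_def)
  from tendsto_diff[OF this]
  have "(\<lambda>n. \<Sum>i\<in>A n. of_real (g i \<omega>) * (a i - b i)) \<longlonglongrightarrow> u - v"
    by (simp add: algebra_simps sum_subtractf)
  with limits show ?case
    by (simp add: rand_series_def lim0_eq)
qed

theorem Lp_norm_le_rand_series_square_diff:
  assumes a_summable: "square_summable a" and b_summable: "square_summable b" and r_ge_1: "1 \<le> r"
  shows "Lp_norm_le r M (\<lambda>\<omega>. (cmod (rand_series a \<omega>))\<^sup>2 - (cmod (rand_series b \<omega>))\<^sup>2)
    (2 * (khinchine_const c)\<^sup>2 * r * (l2_norm a + l2_norm b) * l2_norm (\<lambda>i. a i - b i))"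
proof -
  let ?K = "khinchine_const c * sqrt (2 * r)" and ?d = "\<lambda>i. a i - b i"
  have series_bound: "Lp_norm_le (2 * r) M (\<lambda>\<omega>. cmod (rand_series u \<omega>)) (?K * l2_norm u)"
    if "square_summable u" for u
    using Lp_norm_le_rand_series[OF that, of "2 * r"] r_ge_1
    by (subst Lp_norm_le_norm_iff) (auto dest: Lp_norm_leD)
  note [measurable] = Lp_norm_leD(1)[OF Lp_norm_le_rand_series[OF a_summable r_ge_1]]
    Lp_norm_leD(1)[OF Lp_norm_le_rand_series[OF b_summable r_ge_1]]
  have "Lp_norm_le (2 * r) M (\<lambda>\<omega>. cmod (rand_series a \<omega>) + cmod (rand_series b \<omega>))
      (?K * l2_norm a + ?K * l2_norm b)"
    using r_ge_1 by (intro Minkowski_Lp_norm_le series_bound a_summable b_summable) simp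
  then have "Lp_norm_le r M
      (\<lambda>\<omega>. (cmod (rand_series a \<omega>) + cmod (rand_series b \<omega>)) * cmod (rand_series ?d \<omega>))
      ((?K * l2_norm a + ?K * l2_norm b) * (?K * l2_norm ?d))"
    using r_ge_1
    by (intro Cauchy_Schwarz_Lp_norm_le series_bound square_summable_diff a_summable b_summable)
       auto
  then have "Lp_norm_le r M (\<lambda>\<omega>. (cmod (rand_series a \<omega>))\<^sup>2 - (cmod (rand_series b \<omega>))\<^sup>2)
      ((?K * l2_norm a + ?K * l2_norm b) * (?K * l2_norm ?d))"
  proof (rule Lp_norm_le_mono_AE)
    show "AE \<omega> in M. norm ((cmod (rand_series a \<omega>))\<^sup>2 - (cmod (rand_series b \<omega>))\<^sup>2)
      \<le> norm ((cmod (rand_series a \<omega>) + cmod (rand_series b \<omega>)) * cmod (rand_series ?d \<omega>))"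
      using AE_rand_series_diff[OF a_summable b_summable]
    proof eventually_elim
      case (elim \<omega>)
      show ?case
        using abs_diff_norm_power2_le[of "rand_series a \<omega>" "rand_series b \<omega>"]
        by (simp add: abs_mult elim)
    qed
  qed (use r_ge_1 in auto)
  also have "(?K * l2_norm a + ?K * l2_norm b) * (?K * l2_norm ?d)
      = (khinchine_const c)\<^sup>2 * (sqrt (2 * r) * sqrt (2 * r))
        * (l2_norm a + l2_norm b) * l2_norm ?d"
    by (simp only: power2_eq_square algebra_simps)
  also have "\<dots> = 2 * (khinchine_const c)\<^sup>2 * r * (l2_norm a + l2_norm b) * l2_norm ?d"
    using r_ge_1 by simp
  finally show ?thesis .
qed

end

section \<open>Densities of randomised systems under a dispersive flow\<close>

text \<open>The point \<open>x\<close> is absorbed into the coefficients: for Fourier series,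
  \<open>a j k\<close> is \<open>exp (i x k)\<close> times the \<open>k\<close>-th coefficient of the \<open>j\<close>-th function.\<close>
locale random_density =
  G1: subgaussian_series M1 g1 c A + G2: indep_subgaussian M2 g2 c
  for M1 :: "'a measure" and g1 :: "'i \<Rightarrow> 'a \<Rightarrow> real" and c :: real and A :: "nat \<Rightarrow> 'i set"
    and M2 :: "'b measure" and g2 :: "nat \<Rightarrow> 'b \<Rightarrow> real" +
  fixes lam :: "nat \<Rightarrow> complex" and a :: "nat \<Rightarrow> 'i \<Rightarrow> complex" and \<phi> :: "'i \<Rightarrow> real"
  assumes lam_summable: "square_summable lam"
    and a_summable: "\<And>j. square_summable (a j)" and l2_norm_a_le_1: "\<And>j. l2_norm (a j) \<le> 1"
begin

definition evolved :: "real \<Rightarrow> nat \<Rightarrow> 'i \<Rightarrow> complex" where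
  "evolved t j k = cis (t * \<phi> k) * a j k"

definition orbital_density_diff :: "real \<Rightarrow> nat \<Rightarrow> 'a \<Rightarrow> real" where
  "orbital_density_diff t j \<omega> =
     (cmod (G1.rand_series (evolved 0 j) \<omega>))\<^sup>2 - (cmod (G1.rand_series (evolved t j) \<omega>))\<^sup>2"

definition density_diff :: "real \<Rightarrow> 'a \<times> 'b \<Rightarrow> complex" where
  "density_diff t p =
     series0 (\<lambda>j. lam j * of_real (g2 j (snd p)) * of_real (orbital_density_diff t j (fst p)))"

definition orbital_drift :: "real \<Rightarrow> nat \<Rightarrow> real" where
  "orbital_drift t j = l2_norm (\<lambda>k. evolved 0 j k - evolved t j k)"

definition drift :: "real \<Rightarrow> real" where
  "drift t = l2_norm (\<lambda>j. lam j * of_real (orbital_drift t j))"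

lemma square_summable_evolved: "square_summable (evolved t j)"
  by (rule square_summable_mono[OF a_summable[of j]]) (simp add: evolved_def norm_mult)

lemma l2_norm_evolved_le_1: "l2_norm (evolved t j) \<le> 1"
  using l2_norm_a_le_1[of j] by (simp add: l2_norm_def evolved_def norm_mult)

lemma norm_evolved_diff_le: "cmod (evolved 0 j k - evolved t j k) \<le> cmod (2 * a j k)"
  using norm_triangle_ineq4[of "evolved 0 j k" "evolved t j k"]
  by (simp add: evolved_def norm_mult)

lemma orbital_drift_nonneg [simp]: "0 \<le> orbital_drift t j"
  by (simp add: orbital_drift_def)

lemma drift_nonneg [simp]: "0 \<le> drift t"
  by (simp add: drift_def)

lemma orbital_drift_le_2: "orbital_drift t j \<le> 2"
proof -
  have "orbital_drift t j \<le> l2_norm (\<lambda>k. 2 * a j k)"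
    unfolding orbital_drift_def
    by (intro l2_norm_mono square_summable_cmult a_summable norm_evolved_diff_le)
  then show ?thesis
    using l2_norm_a_le_1[of j] by (simp add: l2_norm_cmult)
qed

lemma norm_lam_orbital_drift_le:
  "cmod (lam j * of_real (orbital_drift t j)) \<le> cmod (2 * lam j)"
  using mult_left_mono[OF orbital_drift_le_2[of t j], of "cmod (lam j)"]
  by (simp add: norm_mult mult.commute)

lemma tendsto_orbital_drift: "((\<lambda>t. orbital_drift t j) \<longlongrightarrow> 0) (nhds 0)"
  unfolding orbital_drift_def
proof (rule tendsto_l2_norm_dominated)
  show "((\<lambda>t. evolved 0 j k - evolved t j k) \<longlongrightarrow> 0) (nhds 0)" for k
  proof -
    have "((\<lambda>t. evolved 0 j k - evolved t j k) \<longlongrightarrow> evolved 0 j k - evolved 0 j k) (nhds 0)"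
      unfolding evolved_def cis_conv_exp by (intro tendsto_intros filterlim_ident)
    then show ?thesis
      by simp
  qed
qed (rule norm_evolved_diff_le square_summable_cmult a_summable)+

lemma tendsto_drift: "(drift \<longlongrightarrow> 0) (nhds 0)"
  unfolding drift_def
proof (rule tendsto_l2_norm_dominated)
  show "((\<lambda>t. lam j * of_real (orbital_drift t j)) \<longlongrightarrow> 0) (nhds 0)" for j
    using tendsto_of_real[OF tendsto_orbital_drift[of j]] by (intro tendsto_mult_right_zero) simp
qed (rule norm_lam_orbital_drift_le square_summable_cmult lam_summable)+

lemma Lp_norm_le_orbital_density_diff:
  assumes r_ge_1: "1 \<le> r"
  shows "Lp_norm_le r M1 (orbital_density_diff t j)
    (4 * (khinchine_const c)\<^sup>2 * r * orbital_drift t j)"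
proof -
  let ?D = "2 * (khinchine_const c)\<^sup>2 * r" and ?e = "\<lambda>t. evolved t j"
  have "Lp_norm_le r M1 (orbital_density_diff t j)
      (?D * (l2_norm (?e 0) + l2_norm (?e t)) * orbital_drift t j)"
    unfolding orbital_density_diff_def[abs_def] orbital_drift_def
    by (intro G1.Lp_norm_le_rand_series_square_diff square_summable_evolved r_ge_1)
  moreover have "?D * (l2_norm (?e 0) + l2_norm (?e t)) * orbital_drift t j
      \<le> ?D * (1 + 1) * orbital_drift t j"
    using r_ge_1
    by (intro mult_left_mono mult_right_mono add_mono l2_norm_evolved_le_1) auto
  ultimately show ?thesis
    using r_ge_1 by (auto elim: Lp_norm_le_weaken)
qed

lemma Lp_norm_le_weighted_orbital_density_diff:
  assumes r_ge_1: "1 \<le> r"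
  shows "Lp_norm_le r M1 (\<lambda>\<omega>. lam j * of_real (orbital_density_diff t j \<omega>))
    (4 * (khinchine_const c)\<^sup>2 * r * cmod (lam j * of_real (orbital_drift t j)))"
proof -
  note orbital_bound = Lp_norm_le_orbital_density_diff[OF r_ge_1, of t j]
  note [measurable] = Lp_norm_leD(1)[OF orbital_bound]
  have "Lp_norm_le r M1 (\<lambda>\<omega>. complex_of_real (orbital_density_diff t j \<omega>))
      (4 * (khinchine_const c)\<^sup>2 * r * orbital_drift t j)"
    by (rule Lp_norm_le_mono_AE[OF orbital_bound]) (use r_ge_1 in auto)
  from Lp_norm_le_cmult[OF this, where z = "lam j"] show ?thesis
    by (simp add: norm_mult mult_ac)
qed

theorem Lp_norm_le_density_diff:
  assumes r_ge_2: "2 \<le> r"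
  shows "Lp_norm_le r (M1 \<Otimes>\<^sub>M M2) (density_diff t)
    (4 * khinchine_const c ^ 3 * r powr (3/2) * drift t)"
  unfolding density_diff_def[abs_def] series0_def
proof (rule Lp_norm_le_lim0)
  let ?K = "khinchine_const c"
  let ?h = "\<lambda>j. cmod (lam j * of_real (orbital_drift t j))"
  fix n
  have "Lp_norm_le r (M1 \<Otimes>\<^sub>M M2)
      (\<lambda>p. \<Sum>j<n. of_real (g2 j (snd p)) * (lam j * of_real (orbital_density_diff t j (fst p))))
      (?K * sqrt r * L2_set (\<lambda>j. 4 * ?K\<^sup>2 * r * ?h j) {..<n})"
    using r_ge_2
    by (intro G2.Lp_norm_le_rand_sum_pair_measure Lp_norm_le_weighted_orbital_density_diff) auto
  moreover have "?K * sqrt r * L2_set (\<lambda>j. 4 * ?K\<^sup>2 * r * ?h j) {..<n}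
      \<le> 4 * ?K ^ 3 * r powr (3/2) * drift t"
  proof -
    have "square_summable (\<lambda>j. lam j * of_real (orbital_drift t j))"
      using square_summable_cmult[OF lam_summable] norm_lam_orbital_drift_le
      by (rule square_summable_mono)
    then have "L2_set ?h {..<n} \<le> drift t"
      unfolding drift_def by (rule L2_set_le_l2_norm) simp
    then have "?K * sqrt r * (4 * ?K\<^sup>2 * r * L2_set ?h {..<n})
        \<le> ?K * sqrt r * (4 * ?K\<^sup>2 * r * drift t)"
      using r_ge_2 khinchine_const_pos[of c] by (intro mult_left_mono) auto
    also have "4 * ?K\<^sup>2 * r * L2_set ?h {..<n} = L2_set (\<lambda>j. 4 * ?K\<^sup>2 * r * ?h j) {..<n}"
      using r_ge_2 by (intro L2_set_right_distrib) simp
    also have "?K * sqrt r * (4 * ?K\<^sup>2 * r * drift t) = 4 * ?K ^ 3 * (r * sqrt r) * drift t"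
      by (simp add: power3_eq_cube power2_eq_square)
    also have "r * sqrt r = r powr (3/2)"
      using r_ge_2 powr_add[of r 1 "1/2"] by (simp add: powr_half_sqrt)
    finally show ?thesis .
  qed
  ultimately show "Lp_norm_le r (M1 \<Otimes>\<^sub>M M2)
      (\<lambda>p. \<Sum>j<n. lam j * of_real (g2 j (snd p)) * of_real (orbital_density_diff t j (fst p)))
      (4 * ?K ^ 3 * r powr (3/2) * drift t)"
    using r_ge_2 by (auto simp: mult_ac elim: Lp_norm_le_weaken)
qed (use r_ge_2 in simp)

theorem small_time_Lp_norm_le_density_diff:
  assumes e_pos: "0 < e"
  shows "\<exists>\<delta>>0. \<forall>t r. \<bar>t\<bar> < \<delta> \<and> 2 \<le> r \<longrightarrow>
    Lp_norm_le r (M1 \<Otimes>\<^sub>M M2) (density_diff t) (4 * khinchine_const c ^ 3 * r powr (3/2) * e)"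
proof -
  have "\<forall>\<^sub>F t in nhds 0. drift t < e"
    using tendsto_drift e_pos by (rule order_tendstoD)
  then obtain \<delta> where delta: "0 < \<delta>" "\<And>t. \<bar>t\<bar> < \<delta> \<Longrightarrow> drift t < e"
    by (auto simp: eventually_nhds_metric dist_real_def)
  have "Lp_norm_le r (M1 \<Otimes>\<^sub>M M2) (density_diff t) (4 * khinchine_const c ^ 3 * r powr (3/2) * e)"
    if "\<bar>t\<bar> < \<delta>" "2 \<le> r" for t r
    using delta(2)[OF that(1)] that(2) khinchine_const_pos[of c]
    by (intro Lp_norm_le_weaken[OF Lp_norm_le_density_diff] mult_left_mono) auto
  with delta(1) show ?thesis
    by blast
qed

theorem tendsto_prob_density_diff:
  assumes l_pos: "0 < l"
  shows "((\<lambda>t. measure (M1 \<Otimes>\<^sub>M M2) {p \<in> space (M1 \<Otimes>\<^sub>M M2). l < cmod (density_diff t p)})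
    \<longlongrightarrow> 0) (at 0)"
proof (rule tendsto_sandwich[OF _ _ tendsto_const])
  interpret pair_prob_space M1 M2 ..
  let ?D = "4 * khinchine_const c ^ 3 * 2 powr (3/2)"
  show "\<forall>\<^sub>F t in at 0. measure (M1 \<Otimes>\<^sub>M M2) {p \<in> space (M1 \<Otimes>\<^sub>M M2). l < cmod (density_diff t p)}
      \<le> (?D * drift t / l) powr 2"
    by (intro always_eventually allI P.Markov_Lp_norm_le Lp_norm_le_density_diff l_pos) auto
  have "(drift \<longlongrightarrow> 0) (at 0)"
    using tendsto_drift by (rule tendsto_mono[rotated]) (simp add: at_within_le_nhds)
  then have "((\<lambda>t. ?D * drift t / l) \<longlongrightarrow> ?D * 0 / l) (at 0)"
    using l_pos by (intro tendsto_intros) auto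
  then show "((\<lambda>t. (?D * drift t / l) powr 2) \<longlongrightarrow> 0) (at 0)"
    using l_pos khinchine_const_pos[of c] by (intro tendsto_zero_powrI[OF _ tendsto_const]) auto
qed auto

end

definition dispersion :: "int \<Rightarrow> real" where
  "dispersion k = sqrt (of_int k ^ 4 + of_int k ^ 2)"

definition fourier_mode :: "real \<Rightarrow> (real \<Rightarrow> complex) \<Rightarrow> int \<Rightarrow> complex" where
  "fourier_mode x f k = cis (x * of_int k) * fourier_coeff f k"

lemma random_density_fourier_mode:
  assumes "indep_subgaussian M1 g1 c" and "indep_subgaussian M2 g2 c"
    and f_coeff: "\<And>j. ((\<lambda>k. (cmod (fourier_coeff (f j) k))\<^sup>2) has_sum 1) UNIV"
    and lam_l2: "summable (\<lambda>j. (cmod (lam j))\<^sup>2)"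
  shows "random_density M1 g1 c (\<lambda>N. {- int N..int N}) M2 g2 lam (\<lambda>j. fourier_mode x (f j))"
proof -
  interpret G1: indep_subgaussian M1 g1 c by fact
  interpret G2: indep_subgaussian M2 g2 c by fact
  show ?thesis
  proof unfold_locales
    show "incseq (\<lambda>N. {- int N..int N})"
      by (auto simp: incseq_def)
    show "square_summable lam"
      using lam_l2 by (simp add: square_summable_def summable_on_UNIV_nonneg_real_iff)
    show "square_summable (fourier_mode x (f j))" "l2_norm (fourier_mode x (f j)) \<le> 1" for j
      using f_coeff[of j]
      by (auto simp: square_summable_def l2_norm_def fourier_mode_def norm_mult has_sum_iff)
  qed simp
qed

theorem theorem1p9:
  fixes M1 :: "'a measure" and M2 :: "'b measure"
    and g1 :: "int \<Rightarrow> 'a \<Rightarrow> real" and g2 :: "nat \<Rightarrow> 'b \<Rightarrow> real"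
    and c :: real
    and f :: "nat \<Rightarrow> real \<Rightarrow> complex" and lam :: "nat \<Rightarrow> complex" and x :: real
  assumes P1: "prob_space M1" and P2: "prob_space M2"
    and c_pos: "c > 0"
    and g1_meas: "\<And>k. g1 k \<in> borel_measurable M1"
    and g1_indep: "prob_space.indep_vars M1 (\<lambda>_. borel) g1 UNIV"
    and g1_int: "\<And>k. integrable M1 (g1 k)"
    and g1_mean: "\<And>k. (\<integral>\<omega>. g1 k \<omega> \<partial>M1) = 0"
    and g1_subg: "\<And>k (\<gamma>::real). (\<integral>\<^sup>+ \<omega>. ennreal (exp (\<gamma> * g1 k \<omega>)) \<partial>M1) \<le> ennreal (exp (c * \<gamma>\<^sup>2))"
    and g2_meas: "\<And>j. g2 j \<in> borel_measurable M2"
    and g2_indep: "prob_space.indep_vars M2 (\<lambda>_. borel) g2 UNIV"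
    and g2_int: "\<And>j. integrable M2 (g2 j)"
    and g2_mean: "\<And>j. (\<integral>\<omega>. g2 j \<omega> \<partial>M2) = 0"
    and g2_subg: "\<And>j (\<gamma>::real). (\<integral>\<^sup>+ \<omega>. ennreal (exp (\<gamma> * g2 j \<omega>)) \<partial>M2) \<le> ennreal (exp (c * \<gamma>\<^sup>2))"
    and f_meas: "\<And>j. f j \<in> borel_measurable lborel"
    and f_L2: "\<And>j. set_integrable lborel {0..<2*pi} (\<lambda>y. (cmod (f j y))\<^sup>2)"
    and f_orth: "\<And>j l. inner_T (f j) (f l) = (if j = l then 1 else 0)"
    and f_coeff: "\<And>j. ((\<lambda>k. (cmod (fourier_coeff (f j) k))\<^sup>2) has_sum 1) UNIV"
    and lam_l2: "summable (\<lambda>j. (cmod (lam j))\<^sup>2)"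
    and x_T: "x \<in> {0..<2*pi}"
  shows "\<exists>C>0. \<forall>\<epsilon>::real. 0 < \<epsilon> \<and> \<epsilon> < 1 \<longrightarrow>
     (let S2 = sqrt (\<Sum>j. (cmod (lam j))\<^sup>2);
          F = (\<lambda>t \<omega> \<omega>'. series0 (\<lambda>j. lam j * complex_of_real (g2 j \<omega>')
                 * complex_of_real ((cmod (rand_prop g1 (f j) 0 x \<omega>))\<^sup>2
                                    - (cmod (rand_prop g1 (f j) t x \<omega>))\<^sup>2)));
          \<alpha>2 = (S2 + 1) * exp 1 * sqrt \<epsilon> * (\<epsilon> * ln (1 / \<epsilon>)) powr (3/2)
      in (\<exists>\<delta>>0. \<forall>t r. \<bar>t\<bar> < \<delta> \<and> r \<ge> 2 \<longrightarrow>
             (\<integral>\<^sup>+ p. ennreal ((cmod (F t (fst p) (snd p))) powr r) \<partial>(M1 \<Otimes>\<^sub>M M2))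
               \<le> ennreal ((C * r powr (3/2) * \<epsilon>\<^sup>2 * (S2 + 1)) powr r))
         \<and> ((\<lambda>t. measure (M1 \<Otimes>\<^sub>M M2)
                 {p \<in> space (M1 \<Otimes>\<^sub>M M2). cmod (F t (fst p) (snd p)) > C * \<alpha>2})
             \<longlongrightarrow> 0) (at 0))"
proof -
  interpret random_density M1 g1 c "\<lambda>N. {- int N..int N}" M2 g2 lam
      "\<lambda>j. fourier_mode x (f j)" dispersion
    by (intro random_density_fourier_mode indep_subgaussian.intro indep_subgaussian_axioms.intro
        P1 P2 g1_indep g2_indep g1_subg g2_subg f_coeff lam_l2)
  have F_eq: "series0 (\<lambda>j. lam j * complex_of_real (g2 j (snd p))
      * complex_of_real ((cmod (rand_prop g1 (f j) 0 x (fst p)))\<^sup>2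
                         - (cmod (rand_prop g1 (f j) t x (fst p)))\<^sup>2)) = density_diff t p" for t p
    unfolding density_diff_def orbital_density_diff_def rand_prop_def G1.rand_series_def evolved_def
      fourier_mode_def dispersion_def by (simp add: mult_ac)
  define C where "C = 4 * khinchine_const c ^ 3"
  have C_pos: "0 < C" and S2_nonneg: "0 \<le> (\<Sum>j. (cmod (lam j))\<^sup>2)"
    using khinchine_const_pos[of c] lam_l2 by (auto simp: C_def intro: suminf_nonneg)
  show ?thesis
    unfolding Let_def F_eq
  proof (rule exI[of _ C], intro conjI allI impI C_pos, goal_cases small_time probability)
    case (small_time \<epsilon>)
    then have "0 < \<epsilon>\<^sup>2 * (sqrt (\<Sum>j. (cmod (lam j))\<^sup>2) + 1)"
      using S2_nonneg by (simp add: add_nonneg_pos)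
    from small_time_Lp_norm_le_density_diff[OF this] show ?case
      by (auto simp: Lp_norm_le_def C_def mult.assoc)
  next
    case (probability \<epsilon>)
    then show ?case
      using C_pos S2_nonneg
      by (intro tendsto_prob_density_diff mult_pos_pos) (auto intro: add_nonneg_pos)
  qed
qed

end
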